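(* For all real $x\ge1$, $S'(x)>\frac{1}{11}x^{1/3}-\frac13$, where $S'(x)$ is the number of elements of $\mathcal{S}$ less than $x$.
   Context: For an integer base $g\ge2$ and integer $m\ge0$, $s_g(m)$ denotes the sum of base-$g$ digits of $m$. A positive integer $m$ has a strict $s$-decomposition if $m=\prod_{\nu=1}^n g_\nu^{e_\nu}$ with exponents $e_\nu\ge1$ and proper factors $1<g_\nu<m$, strictly increasing $g_1<\dots<g_n$ (not necessarily coprime), with $s_{g_\nu}(m)=g_\nu$ for each $\nu$; $\mathcal{S}$ is the set of positive integers having a strict $s$-decomposition. *)

theory Defs
  imports Complex_Main
begin

text \<open>
  The digit of \<open>m\<close> at position \<open>i\<close> in base \<open>g\<close> is \<open>m div g ^ i mod g\<close>. For \<open>g \<ge> 2\<close> one has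
  \<open>m < g ^ i\<close> for all \<open>i \<ge> m\<close>, so the positions up to \<open>m\<close> include all nonzero digits. The
  definition is only meaningful for \<open>g \<ge> 2\<close>.
\<close>

definition digit_sum :: "nat \<Rightarrow> nat \<Rightarrow> nat" where
  "digit_sum g m = (\<Sum>i\<le>m. m div g ^ i mod g)"

text \<open>
  The condition \<open>n \<ge> 1\<close> excludes the empty product, so that \<open>1\<close> has no strict \<open>s\<close>-decomposition.
\<close>

definition has_strict_s_decomposition :: "nat \<Rightarrow> bool" where
  "has_strict_s_decomposition m \<longleftrightarrow>
     m > 0 \<and>
     (\<exists>n\<ge>1. \<exists>g e :: nat \<Rightarrow> nat.
        m = (\<Prod>\<nu>=1..n. g \<nu> ^ e \<nu>) \<and>
        (\<forall>\<nu>\<in>{1..n}. e \<nu> \<ge> 1) \<and>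
        (\<forall>\<nu>\<in>{1..n}. 1 < g \<nu> \<and> g \<nu> < m) \<and>
        strict_mono_on {1..n} g \<and>
        (\<forall>\<nu>\<in>{1..n}. digit_sum (g \<nu>) m = g \<nu>))"

definition S_set :: "nat set" where
  "S_set = {m. has_strict_s_decomposition m}"

definition S_count :: "real \<Rightarrow> nat" where
  "S_count x = card {m \<in> S_set. real m < x}"

end

theory Submission
  imports Defs
begin

text \<open>
  For every \<open>t \<ge> 1\<close> the product \<open>(6 t + 1) (12 t + 1) (18 t + 1)\<close> is a strict \<open>s\<close>-decomposition of its value.
  As \<open>6 * 12 * 18 = 1296 < 11\<^sup>3\<close>, these numbers already have the right density, and the single
  further element \<open>45 = 3\<^sup>2 * 5\<close> makes up for the additive constant.
\<close>

lemma digit_sum_0 [simp]: "digit_sum g 0 = 0"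
  by (simp add: digit_sum_def)

text \<open>Dropping the lowest digit shifts the others down by one position. The two sums then
  still differ in range, but positions \<open>i > b\<close> hold only zeros, as
  \<open>b < 2 ^ b \<le> g ^ i\<close>.\<close>

lemma digit_sum_Cons:
  assumes g: "g \<ge> 2" and a: "a < g"
  shows "digit_sum g (a + g * b) = a + digit_sum g b"
proof (cases "a + g * b = 0")
  case True
  with g show ?thesis by simp
next
  case False
  define m where "m = a + g * b"
  obtain k where k: "m = Suc k" using False m_def not0_implies_Suc by blast
  have mdiv: "m div g = b" and mmod: "m mod g = a" using a by (simp_all add: m_def)
  have "b \<le> k"
  proof (cases "b = 0")
    case False
    then have "2 * b \<le> m" using g by (simp add: m_def trans_le_add2)
    with False k show ?thesis by linarith
  qed simp
  have high: "b div g ^ i mod g = 0" if "i \<in> {..k} - {..b}" for i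
  proof -
    have "b < 2 ^ b" by simp
    also have "\<dots> \<le> (2::nat) ^ i" using that by (intro power_increasing) auto
    also have "\<dots> \<le> g ^ i" using g by (rule power_mono) simp
    finally show ?thesis by simp
  qed
  have "digit_sum g m = m mod g + (\<Sum>i\<le>k. m div g ^ Suc i mod g)"
    by (simp add: digit_sum_def k sum.atMost_Suc_shift del: sum.atMost_Suc)
  also have "(\<Sum>i\<le>k. m div g ^ Suc i mod g) = (\<Sum>i\<le>k. b div g ^ i mod g)"
    by (simp add: div_mult2_eq mdiv)
  also have "\<dots> = digit_sum g b"
    unfolding digit_sum_def using \<open>b \<le> k\<close> high by (intro sum.mono_neutral_right) auto
  finally show ?thesis unfolding mmod by (simp add: m_def)
qed

lemma digit_sum_horner3:
  assumes "g \<ge> 2" "a < g" "b < g" "c < g"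
  shows "digit_sum g (a + g * (b + g * c)) = a + b + c"
  using assms digit_sum_Cons[of g c 0] by (simp add: digit_sum_Cons)

lemma digit_sum_horner4:
  assumes "g \<ge> 2" "a < g" "b < g" "c < g" "d < g"
  shows "digit_sum g (a + g * (b + g * (c + g * d))) = a + b + c + d"
  using assms digit_sum_Cons[of g d 0] by (simp add: digit_sum_Cons)

text \<open>Chernick's form: a Carmichael number whenever the three factors are prime.\<close>

definition U3 :: "nat \<Rightarrow> nat" where
  "U3 t = (6 * t + 1) * (12 * t + 1) * (18 * t + 1)"

lemma atLeastAtMost_1_2: "{1..2::nat} = {1, 2}" and atLeastAtMost_1_3: "{1..3::nat} = {1, 2, 3}"
  by auto

lemma U3_in_S_set:
  assumes "t \<ge> 1"
  shows "U3 t \<in> S_set"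
proof -
  obtain k where k: "t = Suc k" using assms by (cases t) auto
  define g where "g \<nu> = 6 * t * \<nu> + 1" for \<nu>
  \<comment> \<open>In terms of \<open>g = 6*t+1\<close> the factors are \<open>g\<close>,
    \<open>2*g-1\<close>, \<open>3*g-2\<close>, with product \<open>6*g^3 - 7*g^2 + 2*g\<close>.
    Borrowing one \<open>g^3\<close> gives the digits 5, \<open>g-7\<close>, 2, 0; writing
    \<open>t = Suc k\<close> turns \<open>g-7\<close> into \<open>6*k\<close>, free of
    subtraction.\<close>
  have "U3 t = 0 + (6*t+1) * (2 + (6*t+1) * (6*k + (6*t+1) * 5))"
    unfolding U3_def k by (simp add: algebra_simps)
  then have s1: "digit_sum (6*t+1) (U3 t) = 6*t+1"
    using digit_sum_horner4[of "6*t+1" 0 2 "6*k" 5] by (simp add: k)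
  \<comment> \<open>For the other two bases, the upper digits come from dividing the product of the
    two remaining factors by the base.\<close>
  have "U3 t = 0 + (12*t+1) * (3*t + (12*t+1) * (9*t+1))"
    unfolding U3_def by (simp add: algebra_simps)
  then have s2: "digit_sum (12*t+1) (U3 t) = 12*t+1"
    using digit_sum_horner3[of "12*t+1" 0 "3*t" "9*t+1"] by (simp add: k)
  have "U3 t = 0 + (18*t+1) * ((14*t+1) + (18*t+1) * (4*t))"
    unfolding U3_def by (simp add: algebra_simps)
  then have s3: "digit_sum (18*t+1) (U3 t) = 18*t+1"
    using digit_sum_horner3[of "18*t+1" 0 "14*t+1" "4*t"] by (simp add: k)
  have "18*t+1 < U3 t" unfolding U3_def k by (simp add: algebra_simps)
  then have bounds: "\<forall>\<nu>\<in>{1..3}. 1 < g \<nu> \<and> g \<nu> < U3 t"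
    unfolding atLeastAtMost_1_3 using assms by (auto simp: g_def)
  have "U3 t = (\<Prod>\<nu>=1..3. g \<nu> ^ 1)"
    unfolding atLeastAtMost_1_3 by (simp add: U3_def g_def algebra_simps)
  moreover have "strict_mono_on {1..3} g"
    using assms by (intro strict_mono_onI) (simp add: g_def)
  moreover have "\<forall>\<nu>\<in>{1..3}. digit_sum (g \<nu>) (U3 t) = g \<nu>"
    unfolding atLeastAtMost_1_3 using s1 s2 s3 by (simp add: g_def ac_simps)
  moreover have "U3 t > 0" by (simp add: U3_def)
  ultimately show ?thesis
    unfolding S_set_def has_strict_s_decomposition_def using bounds
    by (intro CollectI conjI exI[of _ 3] exI[of _ g] exI[of _ "\<lambda>_. 1"]) auto
qed

lemma forty_five_in_S_set: "45 \<in> S_set"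
proof -
  define g :: "nat \<Rightarrow> nat" where "g \<nu> = 2 * \<nu> + 1" for \<nu>
  define e :: "nat \<Rightarrow> nat" where "e \<nu> = 3 - \<nu>" for \<nu>
  \<comment> \<open>45 is 1200 in base 3 and 140 in base 5.\<close>
  have s: "digit_sum 3 45 = 3" "digit_sum 5 45 = 5"
    using digit_sum_horner4[of 3 0 0 2 1] digit_sum_horner3[of 5 0 4 1] by simp_all
  have "strict_mono_on {1..2} g"
    by (intro strict_mono_onI) (simp add: g_def)
  moreover have "\<forall>\<nu>\<in>{1..2}. digit_sum (g \<nu>) 45 = g \<nu>"
    unfolding atLeastAtMost_1_2 using s by (simp add: g_def)
  moreover have "45 = (\<Prod>\<nu>=1..2. g \<nu> ^ e \<nu>)"
    unfolding atLeastAtMost_1_2 by (simp add: g_def e_def)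
  moreover have "\<forall>\<nu>\<in>{1..2}. e \<nu> \<ge> 1" "\<forall>\<nu>\<in>{1..2}. 1 < g \<nu> \<and> g \<nu> < 45"
    by (auto simp: g_def e_def)
  ultimately show ?thesis
    unfolding S_set_def has_strict_s_decomposition_def
    by (intro CollectI conjI exI[of _ 2] exI[of _ g] exI[of _ e]) auto
qed

lemma strict_mono_U3: "strict_mono U3"
proof (rule strict_monoI)
  fix s t :: nat assume "s < t"
  then show "U3 s < U3 t"
    unfolding U3_def by (intro mult_strict_mono) auto
qed

theorem theorem2p8:
  fixes x :: real
  assumes "x \<ge> 1"
  shows "real (S_count x) > 1 / 11 * x powr (1 / 3) - 1 / 3"
proof -
  have root_less: "x powr (1/3) < y" if "x < y ^ 3" "y > 0" for y
  proof -
    have pow: "y ^ 3 = y powr 3" using that by simp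
    have "x powr (1/3) < (y ^ 3) powr (1/3)"
      using assms that by (intro powr_less_mono2) auto
    also have "\<dots> = y"
      unfolding pow powr_powr using that by simp
    finally show ?thesis .
  qed
  show ?thesis
  proof (cases "x \<le> 45")
    case True
    \<comment> \<open>Since \<open>(11/3)^3 = 1331/27 > 45\<close>, the claimed lower bound is
      negative here, so any count satisfies it.\<close>
    then have "x powr (1/3) < 11/3" by (intro root_less) (auto simp: power3_eq_cube)
    then show ?thesis by (simp add: field_simps)
  next
    case False
    \<comment> \<open>By minimality and monotonicity, \<open>n\<close> counts the indices
      \<open>t \<ge> 1\<close> with \<open>U3 t < x\<close>.\<close>
    define n where "n = (LEAST n. x \<le> U3 (Suc n))"
    have "\<exists>n. x \<le> U3 (Suc n)"
    proof
      \<comment> \<open>A strictly increasing function on the naturals satisfies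
        \<open>m \<le> U3 m\<close>.\<close>
      have "x \<le> real (Suc (nat \<lceil>x\<rceil>))" by linarith
      also have "\<dots> \<le> U3 (Suc (nat \<lceil>x\<rceil>))"
        using strict_mono_imp_increasing[OF strict_mono_U3] by (simp only: of_nat_le_iff)
      finally show "x \<le> U3 (Suc (nat \<lceil>x\<rceil>))" .
    qed
    then have ub: "x \<le> U3 (Suc n)"
      unfolding n_def by (rule LeastI_ex)
    have lb: "U3 t < x" if "t \<in> {1..n}" for t
      using that not_less_Least[of "t - 1" "\<lambda>n. x \<le> U3 (Suc n)", folded n_def] by force
    \<comment> \<open>The smallest value in the family is
      \<open>U3 1 = 7 * 13 * 19 = 1729\<close>.\<close>
    have "45 \<notin> U3 ` {1..n}"
    proof
      assume "45 \<in> U3 ` {1..n}"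
      then obtain t where "t \<ge> 1" "U3 t = 45" by auto
      moreover from this have "U3 1 \<le> U3 t"
        using strict_mono_less_eq[OF strict_mono_U3] by blast
      ultimately show False by (simp add: U3_def)
    qed
    then have "Suc n = card (insert 45 (U3 ` {1..n}))"
      using strict_mono_imp_inj_on[OF strict_mono_U3]
      by (simp add: card_image inj_on_subset)
    also have "\<dots> \<le> S_count x"
      unfolding S_count_def
    proof (rule card_mono)
      show "finite {m \<in> S_set. real m < x}"
        by (rule finite_subset[of _ "{..nat \<lceil>x\<rceil>}"]) (auto, linarith)
      show "insert 45 (U3 ` {1..n}) \<subseteq> {m \<in> S_set. real m < x}"
        using lb False by (auto intro: U3_in_S_set forty_five_in_S_set)
    qed
    finally have count: "Suc n \<le> S_count x" .
    \<comment> \<open>Thanks to 45, the count reaches \<open>n + 1\<close>, the very index at which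
      \<open>U3\<close> bounds \<open>x\<close> from above.\<close>
    define s where "s = real (Suc n)"
    have "s \<ge> 1" by (simp add: s_def)
    have "x \<le> (6 * s + 1) * (12 * s + 1) * (18 * s + 1)"
      using ub by (simp add: U3_def s_def)
    also have "\<dots> = 1296 * s ^ 3 + 396 * s ^ 2 + 36 * s + 1"
      by (simp add: algebra_simps power2_eq_square power3_eq_cube)
    \<comment> \<open>The goal amounts to \<open>x powr (1/3) < 11 * s + 11 / 3\<close>. The right
      side is the expanded cube of that bound, and it dominates coefficient by coefficient.\<close>
    also have "\<dots> < 1331 * s ^ 3 + 1331 * s ^ 2 + 1331 / 3 * s + 1331 / 27"
      using \<open>s \<ge> 1\<close> by (intro add_strict_mono add_mono) auto
    also have "\<dots> = (11 * s + 11 / 3) ^ 3"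
      by (simp add: field_simps power2_eq_square power3_eq_cube)
    finally have "x powr (1/3) < 11 * s + 11 / 3"
      using \<open>s \<ge> 1\<close> by (intro root_less) auto
    moreover have "s \<le> S_count x"
      using count by (simp only: s_def of_nat_le_iff)
    ultimately show ?thesis by linarith
  qed
qed

end
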